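(* Let $k\ge 2$ be an integer, and let $P_n$ denote the path on $n$ vertices. (a) For every $n\ge 1$, $c_k(P_n) = \left\lfloor \frac{(k-2)n}{k-1} \right\rfloor + 1$. (b) For every $n\ge k-1$, the optimal coloring of $P_n$ (a coloring with no rainbow $P_k$ using exactly $c_k(P_n)$ colors) is unique, up to renaming of colors, if and only if $n$ is a multiple of $k-1$.
   Context: A coloring of a finite simple undirected graph $G$ is an assignment of a color to each vertex; it need not be proper. A subgraph (not necessarily induced) is rainbow if all its vertices receive pairwise different colors. $P_k$ denotes the path with $k$ vertices. $c_k(G)$ is the maximum number of different colors used in a (not necessarily proper) coloring of the vertices of $G$ having no rainbow subgraph isomorphic to $P_k$. Two colorings are regarded as the same if they differ only by renaming colors, i.e. if they induce the same partition of the vertex set into color classes. *)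

theory Defs
  imports Complex_Main "Graph_Theory.Graph_Theory"
begin

text \<open>
  A finite simple undirected graph is a \<^locale>\<open>graph\<close>: an undirected edge is a pair of
  opposite arcs, and the arc set is symmetric. A subgraph isomorphic to a symmetric digraph is
  itself symmetric, so the subgraphs isomorphic to a path below are subgraphs in the undirected
  sense.
\<close>

definition path_graph :: "nat \<Rightarrow> (nat, nat \<times> nat) pre_digraph" where
  "path_graph n = with_proj \<lparr> pverts = {..<n},
     parcs = {(i, j). i < n \<and> j < n \<and> (j = Suc i \<or> i = Suc j)} \<rparr>"

lemma graph_path_graph: "graph (path_graph n)"
proof -
  let ?P = "\<lparr> pverts = {..<n},
     parcs = {(i, j). i < n \<and> j < n \<and> (j = Suc i \<or> i = Suc j)} \<rparr>"
  have fin: "finite {(i, j). i < n \<and> j < n \<and> (j = Suc i \<or> i = Suc j)}"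
    by (rule finite_subset[of _ "{..<n} \<times> {..<n}"]) auto
  have sym: "symmetric (with_proj ?P)"
    unfolding symmetric_def with_proj_simps sym_def by (simp, blast)
  have wf: "pair_wf_digraph ?P"
    by (rule pair_wf_digraph.intro) auto
  interpret pair_graph ?P
    using wf fin sym
    by (intro pair_graph.intro pair_digraph.intro pair_pseudo_graph.intro
        pair_fin_digraph.intro pair_sym_digraph.intro pair_loopfree_digraph.intro
        pair_fin_digraph_axioms.intro pair_sym_digraph_axioms.intro
        pair_loopfree_digraph_axioms.intro) auto
  show ?thesis
    unfolding path_graph_def by (rule graph_axioms)
qed

text \<open>
  Since only finite graphs are coloured, natural numbers provide enough colours. A colouring is
  relevant only through its values on the vertices.
\<close>

definition rainbow :: "('a \<Rightarrow> nat) \<Rightarrow> ('a, 'b) pre_digraph \<Rightarrow> bool" where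
  "rainbow c H \<longleftrightarrow> inj_on c (verts H)"

definition rainbow_path_free :: "nat \<Rightarrow> ('a, 'b) pre_digraph \<Rightarrow> ('a \<Rightarrow> nat) \<Rightarrow> bool" where
  "rainbow_path_free k G c \<longleftrightarrow>
     \<not> (\<exists>H. subgraph H G \<and> digraph_iso H (path_graph k) \<and> rainbow c H)"

definition num_colors :: "('a, 'b) pre_digraph \<Rightarrow> ('a \<Rightarrow> nat) \<Rightarrow> nat" where
  "num_colors G c = card (c ` verts G)"

definition max_colors :: "nat \<Rightarrow> ('a, 'b) pre_digraph \<Rightarrow> nat" where
  "max_colors k G = Max {num_colors G c | c. rainbow_path_free k G c}"

definition optimal_coloring :: "nat \<Rightarrow> ('a, 'b) pre_digraph \<Rightarrow> ('a \<Rightarrow> nat) \<Rightarrow> bool" where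
  "optimal_coloring k G c \<longleftrightarrow> rainbow_path_free k G c \<and> num_colors G c = max_colors k G"

definition color_classes :: "('a, 'b) pre_digraph \<Rightarrow> ('a \<Rightarrow> nat) \<Rightarrow> 'a set set" where
  "color_classes G c = {{v \<in> verts G. c v = i} | i. i \<in> c ` verts G}"

definition same_coloring :: "('a, 'b) pre_digraph \<Rightarrow> ('a \<Rightarrow> nat) \<Rightarrow> ('a \<Rightarrow> nat) \<Rightarrow> bool" where
  "same_coloring G c d \<longleftrightarrow> color_classes G c = color_classes G d"

definition unique_optimal_coloring :: "nat \<Rightarrow> ('a, 'b) pre_digraph \<Rightarrow> bool" where
  "unique_optimal_coloring k G \<longleftrightarrow>
     (\<exists>c. optimal_coloring k G c \<and> (\<forall>d. optimal_coloring k G d \<longrightarrow> same_coloring G c d))"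

text \<open>
  For \<open>k \<ge> 2\<close> and a finite graph the maximum in \<^const>\<open>max_colors\<close> ranges over a finite nonempty
  set.
\<close>

lemma finite_num_colors:
  assumes "finite (verts G)"
  shows "finite {num_colors G c | c. rainbow_path_free k G c}"
proof (rule finite_subset)
  show "{num_colors G c | c. rainbow_path_free k G c} \<subseteq> {..card (verts G)}"
    using assms by (auto simp: num_colors_def card_image_le)
qed simp

lemma rainbow_path_free_const:
  fixes G :: "('a, 'b) pre_digraph"
  assumes "k \<ge> 2"
  shows "rainbow_path_free k G (\<lambda>_. a)"
  unfolding rainbow_path_free_def
proof (rule notI, elim exE conjE)
  fix H :: "('a, 'b) pre_digraph"
  assume iso: "digraph_iso H (path_graph k)" and r: "rainbow (\<lambda>_. a) H"
  from iso obtain f where iso_f: "path_graph k = app_iso f H"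
    unfolding digraph_iso_def by blast
  have "verts (path_graph k) = {..<k}"
    by (simp add: path_graph_def)
  then have verts_f: "iso_verts f ` verts H = {..<k}"
    by (simp add: iso_f)
  have "0 \<in> iso_verts f ` verts H" "1 \<in> iso_verts f ` verts H"
    using assms unfolding verts_f by simp_all
  then obtain u v where uv: "u \<in> verts H" "v \<in> verts H" "0 = iso_verts f u" "1 = iso_verts f v"
    by (elim imageE)
  from r uv(1,2) have "u = v" by (auto simp: rainbow_def inj_on_def)
  with uv(3,4) show False by simp
qed

lemma optimal_coloring_exists:
  assumes "k \<ge> 2" "finite (verts G)"
  shows "\<exists>c. optimal_coloring k G c"
proof -
  have "max_colors k G \<in> {num_colors G c | c. rainbow_path_free k G c}"
    unfolding max_colors_def
    using finite_num_colors[OF assms(2)] rainbow_path_free_const[OF assms(1)]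
    by (intro Max_in) auto
  then show ?thesis by (auto simp: optimal_coloring_def)
qed

end

theory Submission
  imports Defs
begin

text \<open>
  Put \<open>m = k - 1\<close>. A coloring of \<open>P\<^sub>n\<close> has no rainbow \<open>P\<^sub>k\<close> iff every window \<open>[a, a + m]\<close> contains
  two vertices of the same color. Call a vertex a repeat if its color occurs again later; the number
  of colors is \<open>n\<close> minus the number of repeats. Windows whose starting points are at least \<open>m\<close> apart
  contribute different repeats, since the earlier vertex of a monochromatic pair is not the last
  vertex of its window. Hence there are at least \<open>(n - 1) div m\<close> repeats, which is attained by
  merging the vertices \<open>j m - 1\<close> and \<open>j m\<close> for all \<open>j\<close>.

  If \<open>m\<close> does not divide \<open>n\<close>, merging \<open>j m - 2\<close> and \<open>j m - 1\<close> instead is optimal as well. If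
  \<open>n = q m\<close>, an optimal coloring has exactly \<open>q - 1\<close> repeats. A repeat not congruent to \<open>m - 1\<close>
  modulo \<open>m\<close> could be avoided by \<open>q - 1\<close> windows of the above kind, so the repeats are the
  vertices \<open>j m - 1\<close>, and the window starting at \<open>(j - 1) m\<close> forces \<open>j m\<close> to have the color of
  \<open>j m - 1\<close>.
\<close>

section \<open>Path subgraphs of a path are windows of consecutive vertices\<close>

lemma verts_path_graph [simp]: "verts (path_graph n) = {..<n}"
  and arcs_path_graph [simp]:
    "arcs (path_graph n) = {(i, j). i < n \<and> j < n \<and> (j = Suc i \<or> i = Suc j)}"
  and tail_path_graph [simp]: "tail (path_graph n) = fst"
  and head_path_graph [simp]: "head (path_graph n) = snd"
  by (simp_all add: path_graph_def)

lemma wf_digraph_path_graph: "wf_digraph (path_graph n)"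
  using graph_path_graph[of n]
  by (simp add: graph_def digraph_def fin_digraph_def)

text \<open>A discrete intermediate value argument: each new value is adjacent to a value already in
  the interval, so it lies inside or extends one end by one.\<close>

lemma image_unit_steps_eq_interval:
  fixes g :: "nat \<Rightarrow> nat"
  assumes "\<And>i. Suc i < k \<Longrightarrow> g (Suc i) = Suc (g i) \<or> g i = Suc (g (Suc i))"
    and "t < k"
  shows "\<exists>a b. a \<le> b \<and> g ` {..t} = {a..b}"
  using assms(2)
proof (induction t)
  case 0
  show ?case by (intro exI[of _ "g 0"]) auto
next
  case (Suc t)
  then obtain a b where ab: "a \<le> b" "g ` {..t} = {a..b}" by auto
  have "g t \<in> {a..b}" using ab by blast
  with assms(1)[OF Suc.prems] consider "g (Suc t) \<in> {a..b}" | "g (Suc t) = Suc b" | "Suc (g (Suc t)) = a"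
    by fastforce
  then show ?case
  proof cases
    case 1
    then show ?thesis using ab by (auto simp: atMost_Suc insert_absorb)
  next
    case 2
    then have "g ` {..Suc t} = {a..Suc b}" using ab by (auto simp: atMost_Suc)
    then show ?thesis using ab by (intro exI[of _ a] exI[of _ "Suc b"]) auto
  next
    case 3
    then have "g ` {..Suc t} = {g (Suc t)..b}" using ab by (auto simp: atMost_Suc)
    then show ?thesis using ab 3 by (intro exI[of _ "g (Suc t)"] exI[of _ b]) auto
  qed
qed

text \<open>The inverse \<open>g\<close> of the isomorphism walks through \<open>H\<close>. Arcs of
  \<open>path_graph n\<close> join only consecutive numbers, so \<open>g\<close> moves by unit steps
  and its image is an interval; counting vertices gives the length.\<close>

lemma verts_path_subgraph_path_graph:
  assumes "subgraph H (path_graph n)" "digraph_iso H (path_graph (Suc m))"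
  obtains a where "a + m < n" "verts H = {a..a + m}"
proof -
  from assms(2) obtain f where f: "pre_digraph.digraph_isomorphism H f"
    and eq: "path_graph (Suc m) = app_iso f H"
    by (auto simp: digraph_iso_def)
  have wfH: "wf_digraph H" and sub: "verts H \<subseteq> {..<n}" "arcs H \<subseteq> arcs (path_graph n)"
    and th: "tail H = fst" "head H = snd"
    using assms(1) by (auto simp: subgraph_def compatible_def)
  define g where "g = the_inv_into (verts H) (iso_verts f)"
  have inj: "inj_on (iso_verts f) (verts H)"
    and ends: "\<And>e. e \<in> arcs H \<Longrightarrow> iso_verts f (fst e) = iso_tail f (iso_arcs f e) \<and>
      iso_verts f (snd e) = iso_head f (iso_arcs f e)"
    using f th by (auto simp: pre_digraph.digraph_isomorphism_def)
  have img: "iso_verts f ` verts H = {..<Suc m}"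
    using arg_cong[OF eq, of verts] by simp
  have arcs: "iso_arcs f ` arcs H = arcs (path_graph (Suc m))"
    using arg_cong[OF eq, of arcs] by simp
  \<comment> \<open>Equality of digraphs includes their tail and head maps, so the projections
    chosen by \<open>f\<close> are determined.\<close>
  have iso_th: "iso_tail f = fst" "iso_head f = snd"
    using arg_cong[OF eq, of tail] arg_cong[OF eq, of head] by simp_all
  have bij: "bij_betw g {..<Suc m} (verts H)"
    unfolding g_def by (rule bij_betw_the_inv_into) (use inj img in \<open>simp add: bij_betw_def\<close>)
  have step: "g (Suc i) = Suc (g i) \<or> g i = Suc (g (Suc i))" if "Suc i < Suc m" for i
  proof -
    from that have "(i, Suc i) \<in> iso_arcs f ` arcs H" by (simp add: arcs)
    then obtain e where e: "e \<in> arcs H" "iso_arcs f e = (i, Suc i)" by auto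
    from wfH e th have "fst e \<in> verts H" "snd e \<in> verts H"
      using wf_digraph.wellformed[of H e] by auto
    moreover have "iso_verts f (fst e) = i" "iso_verts f (snd e) = Suc i"
      using ends[OF e(1)] e(2) iso_th by auto
    ultimately have "g i = fst e" "g (Suc i) = snd e"
      using the_inv_into_f_f[OF inj, of "fst e"] the_inv_into_f_f[OF inj, of "snd e"]
      by (simp_all add: g_def)
    with e sub show ?thesis by (auto simp: subset_iff)
  qed
  from image_unit_steps_eq_interval[of "Suc m" g m, OF step]
  obtain a b where ab: "a \<le> b" "g ` {..m} = {a..b}" by auto
  have H: "verts H = {a..b}"
    using bij ab by (simp add: bij_betw_def lessThan_Suc_atMost)
  have "card (verts H) = Suc m"
    using bij_betw_same_card[OF bij] by simp
  with H ab have b: "b = a + m" by simp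
  show thesis
    by (rule that[of a]) (use H b sub in auto)
qed

lemma path_subgraph_path_graph:
  assumes "a + m < n"
  obtains H where "subgraph H (path_graph n)" "digraph_iso H (path_graph (Suc m))"
    "verts H = {a..a + m}"
proof -
  let ?A = "{(i, j). i \<in> {a..a + m} \<and> j \<in> {a..a + m} \<and> (j = Suc i \<or> i = Suc j)}"
  define H where "H = \<lparr>verts = {a..a + m}, arcs = ?A, tail = fst, head = snd\<rparr>"
  define f :: "(nat, nat \<times> nat, nat, nat \<times> nat) digraph_isomorphism" where
    "f = \<lparr>iso_verts = (\<lambda>v. v - a), iso_arcs = map_prod (\<lambda>v. v - a) (\<lambda>v. v - a),
      iso_head = snd, iso_tail = fst\<rparr>"
  have wf: "wf_digraph H" by unfold_locales (auto simp: H_def)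
  have "subgraph H (path_graph n)"
    using assms wf wf_digraph_path_graph by (auto simp: subgraph_def compatible_def H_def)
  moreover have "pre_digraph.digraph_isomorphism H f"
    using wf unfolding pre_digraph.digraph_isomorphism_def
    by (auto simp: H_def f_def inj_on_def)
  moreover have "path_graph (Suc m) = app_iso f H"
  proof -
    have "{..<Suc m} = (\<lambda>v. v - a) ` {a..a + m}"
      by (auto simp: image_def intro!: bexI[of _ "_ + a"])
    moreover have "arcs (path_graph (Suc m)) = map_prod (\<lambda>v. v - a) (\<lambda>v. v - a) ` ?A"
    proof (intro equalityI subsetI)
      fix e assume "e \<in> arcs (path_graph (Suc m))"
      then show "e \<in> map_prod (\<lambda>v. v - a) (\<lambda>v. v - a) ` ?A"
        by (intro image_eqI[of _ _ "(fst e + a, snd e + a)"]) auto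
    qed auto
    ultimately show ?thesis
      by (intro pre_digraph.equality) (simp_all add: H_def f_def)
  qed
  ultimately show thesis
    using that[of H] by (auto simp: digraph_iso_def H_def)
qed

text \<open>This removes subgraphs and isomorphisms from the problem; what follows is arithmetic on
  windows.\<close>

lemma rainbow_path_free_path_graph_iff:
  "rainbow_path_free (Suc m) (path_graph n) c \<longleftrightarrow>
     (\<forall>a. a + m < n \<longrightarrow> (\<exists>i j. a \<le> i \<and> i < j \<and> j \<le> a + m \<and> c i = c j))"
proof -
  have "rainbow_path_free (Suc m) (path_graph n) c \<longleftrightarrow>
      (\<forall>a. a + m < n \<longrightarrow> \<not> inj_on c {a..a + m})"
    unfolding rainbow_path_free_def rainbow_def
    by (metis path_subgraph_path_graph verts_path_subgraph_path_graph)
  also have "\<dots> \<longleftrightarrow> (\<forall>a. a + m < n \<longrightarrow> (\<exists>i j. a \<le> i \<and> i < j \<and> j \<le> a + m \<and> c i = c j))"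
  proof (intro all_cong)
    fix a
    show "(\<not> inj_on c {a..a + m}) = (\<exists>i j. a \<le> i \<and> i < j \<and> j \<le> a + m \<and> c i = c j)"
    proof
      assume "\<not> inj_on c {a..a + m}"
      then obtain i j where "i \<in> {a..a + m}" "j \<in> {a..a + m}" "i < j" "c i = c j"
        using linorder_inj_onI'[of "{a..a + m}" c] by blast
      then show "\<exists>i j. a \<le> i \<and> i < j \<and> j \<le> a + m \<and> c i = c j" by auto
    qed (force simp: inj_on_def)
  qed
  finally show ?thesis .
qed

section \<open>Counting repeats: the upper bound on the number of colors\<close>

definition repeats :: "(nat \<Rightarrow> nat) \<Rightarrow> nat \<Rightarrow> nat set" where
  "repeats c n = {i. \<exists>j. i < j \<and> j < n \<and> c i = c j}"

lemma repeats_subset: "repeats c n \<subseteq> {..<n}"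
  by (auto simp: repeats_def)

text \<open>Each color class contains exactly one non-repeat, its last vertex.\<close>

lemma card_colors_add_card_repeats: "card (c ` {..<n}) + card (repeats c n) = n"
proof -
  have "inj_on c ({..<n} - repeats c n)"
    by (rule inj_onI) (auto simp: repeats_def, metis nat_neq_iff)
  moreover have "c ` ({..<n} - repeats c n) = c ` {..<n}"
  proof (intro equalityI subsetI)
    fix y assume "y \<in> c ` {..<n}"
    define S where "S = {i. i < n \<and> c i = y}"
    have S: "finite S" "S \<noteq> {}" using \<open>y \<in> c ` {..<n}\<close> by (auto simp: S_def)
    have "Max S \<in> S" using S by simp
    moreover have "j \<le> Max S" if "j < n" "c j = y" for j
      using that S by (auto simp: S_def)
    ultimately show "y \<in> c ` ({..<n} - repeats c n)"
      by (intro image_eqI[of _ _ "Max S"]) (auto simp: S_def repeats_def leD)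
  qed auto
  ultimately have "card (c ` {..<n}) = card ({..<n} - repeats c n)"
    by (metis card_image)
  also have "\<dots> = n - card (repeats c n)"
    using repeats_subset[of c n] by (simp add: card_Diff_subset finite_subset)
  finally show ?thesis
    using card_mono[OF _ repeats_subset[of c n]] by simp
qed

text \<open>The starting points \<open>s\<close> are left free because two choices occur: multiples
  of \<open>m\<close> for the bound, and a choice with a gap around a given vertex for uniqueness.
  The intervals \<open>{s j..<s j + m}\<close> are disjoint, hence injectivity.\<close>

lemma rainbow_path_free_repeats:
  fixes s :: "nat \<Rightarrow> nat"
  assumes "rainbow_path_free (Suc m) (path_graph n) c"
    and "\<And>j. j < t \<Longrightarrow> s j + m < n"
    and "\<And>i j. i < j \<Longrightarrow> j < t \<Longrightarrow> s i + m \<le> s j"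
  obtains f where "inj_on f {..<t}"
    and "\<And>j. j < t \<Longrightarrow> f j \<in> repeats c n \<and> s j \<le> f j \<and> f j < s j + m"
proof -
  have "\<exists>i. i \<in> repeats c n \<and> s j \<le> i \<and> i < s j + m" if "j < t" for j
  proof -
    from assms(1) assms(2)[OF that]
    obtain i i' where "s j \<le> i" "i < i'" "i' \<le> s j + m" "c i = c i'"
      unfolding rainbow_path_free_path_graph_iff by blast
    with assms(2)[OF that] show ?thesis
      unfolding repeats_def by (intro exI[of _ i]) auto
  qed
  then obtain f where f: "\<And>j. j < t \<Longrightarrow> f j \<in> repeats c n \<and> s j \<le> f j \<and> f j < s j + m"
    by metis
  have "inj_on f {..<t}"
  proof (rule linorder_inj_onI)
    fix i j assume "i < j" "i \<in> {..<t}" "j \<in> {..<t}"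
    with assms(3)[of i j] f[of i] f[of j] show "f i \<noteq> f j" by auto
  qed auto
  with f show thesis using that by blast
qed

lemma rainbow_path_free_num_colors_le:
  assumes "rainbow_path_free (Suc m) (path_graph n) c" "n \<ge> 1"
  shows "num_colors (path_graph n) c \<le> n - (n - 1) div m"
proof (cases "m = 0")
  case True
  \<comment> \<open>Division by zero yields 0, so the bound is the trivial one,
    \<open>n\<close>.\<close>
  then show ?thesis using card_image_le[of "{..<n}" c] by (simp add: num_colors_def)
next
  case False
  define t where "t = (n - 1) div m"
  have 1: "j * m + m < n" if "j < t" for j
  proof -
    have "Suc j * m \<le> t * m" using that by (intro mult_right_mono) auto
    also have "\<dots> \<le> n - 1" by (simp add: t_def)
    finally show ?thesis using assms(2) by simp
  qed
  have 2: "i * m + m \<le> j * m" if "i < j" for i j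
  proof -
    have "Suc i * m \<le> j * m" using that by (intro mult_right_mono) auto
    then show ?thesis by simp
  qed
  obtain f where f: "inj_on f {..<t}" "\<And>j. j < t \<Longrightarrow> f j \<in> repeats c n"
    using rainbow_path_free_repeats[OF assms(1), of t "\<lambda>j. j * m"] 1 2 by metis
  have "t \<le> card (repeats c n)"
    using card_inj_on_le[OF f(1), of "repeats c n"] f(2) finite_subset[OF repeats_subset]
    by fastforce
  with card_colors_add_card_repeats[of c n] show ?thesis
    by (simp add: num_colors_def t_def)
qed

section \<open>Extremal colorings and the maximum number of colors\<close>

text \<open>The quotient counts the merges made so far. For \<open>s = 0\<close> the vertices
  \<open>j * m - 1\<close> and \<open>j * m\<close> are merged; \<open>s = 1\<close> moves every
  merge one vertex to the left.\<close>

definition block_coloring :: "nat \<Rightarrow> nat \<Rightarrow> nat \<Rightarrow> nat" where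
  "block_coloring m s v = v - (v + s) div m"

lemma block_coloring_Suc:
  assumes "m > 0" "s \<le> 1"
  shows "block_coloring m s (Suc v) =
    (if m dvd Suc v + s then block_coloring m s v else Suc (block_coloring m s v))"
proof (cases "m dvd Suc v + s")
  case True
  then show ?thesis
    using assms by (auto simp: block_coloring_def div_Suc dvd_eq_mod_eq_0)
next
  case False
  \<comment> \<open>Truncated subtraction could break the increment, so \<open>(v + s) div m\<close>
    must not exceed \<open>v\<close>; \<open>m \<ge> 2\<close> and \<open>s \<le> 1\<close> ensure
    this.\<close>
  then have "m \<ge> 2" using assms by (cases "m = 1") auto
  then have "(v + s) div m \<le> (v + s) div 2" by (simp add: div_le_mono2)
  also have "\<dots> \<le> v" using assms by linarith
  finally have "(v + s) div m \<le> v" .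
  then show ?thesis
    using False by (simp add: block_coloring_def div_Suc dvd_eq_mod_eq_0)
qed

text \<open>The coloring starts at 0 and each step keeps the color or raises it by one, so no color
  is skipped and the last vertex determines their number.\<close>

lemma block_coloring_image:
  assumes "m > 0" "s \<le> 1"
  shows "block_coloring m s ` {..n} = {..block_coloring m s n}"
proof (induction n)
  case 0
  show ?case by (auto simp: block_coloring_def)
next
  case (Suc n)
  then show ?case
    using block_coloring_Suc[OF assms, of n]
    by (auto simp: atMost_Suc insert_absorb split: if_splits)
qed

lemma num_colors_block_coloring:
  assumes "m > 0" "s \<le> 1" "n \<ge> 1" "(n - 1 + s) div m \<le> n - 1"
  shows "num_colors (path_graph n) (block_coloring m s) = n - (n - 1 + s) div m"
proof -
  have "{..<n} = {..n - 1}" using assms(3) by auto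
  then show ?thesis
    using assms block_coloring_image[OF assms(1,2), of "n - 1"]
    by (simp add: num_colors_def block_coloring_def)
qed

lemma rainbow_path_free_block_coloring:
  assumes "m > 0" "s \<le> 1"
  shows "rainbow_path_free (Suc m) (path_graph n) (block_coloring m s)"
  unfolding rainbow_path_free_path_graph_iff
proof (intro allI impI)
  fix a assume "a + m < n"
  \<comment> \<open>The first number \<open>w\<close> above \<open>a\<close> with
    \<open>m dvd w + s\<close> is \<open>a + m - r\<close>. It is at most \<open>a + m\<close>, so
    the merged pair \<open>w - 1\<close>, \<open>w\<close> lies in the window.\<close>
  define r where "r = (a + s) mod m"
  have r: "r < m" using assms by (simp add: r_def)
  have "m dvd a + s - r" by (simp add: r_def minus_mod_eq_mult_div)
  moreover have "r \<le> a + s" by (simp add: r_def)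
  moreover have "Suc (a + (m - 1 - r)) + s = (a + s - r) + m" using r \<open>r \<le> a + s\<close> by simp
  ultimately have "m dvd Suc (a + (m - 1 - r)) + s" by (metis dvd_add dvd_refl)
  then have "block_coloring m s (Suc (a + (m - 1 - r))) = block_coloring m s (a + (m - 1 - r))"
    using block_coloring_Suc[OF assms, of "a + (m - 1 - r)"] by simp
  then show "\<exists>i j. a \<le> i \<and> i < j \<and> j \<le> a + m \<and> block_coloring m s i = block_coloring m s j"
    using r by (intro exI[of _ "a + (m - 1 - r)"] exI[of _ "Suc (a + (m - 1 - r))"]) auto
qed

lemma max_colors_path_graph:
  assumes "m > 0" "n \<ge> 1"
  shows "max_colors (Suc m) (path_graph n) = n - (n - 1) div m"
  unfolding max_colors_def
proof (rule Max_eqI)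
  show "finite {num_colors (path_graph n) c | c. rainbow_path_free (Suc m) (path_graph n) c}"
    by (rule finite_num_colors) simp
  show "y \<le> n - (n - 1) div m"
    if "y \<in> {num_colors (path_graph n) c | c. rainbow_path_free (Suc m) (path_graph n) c}" for y
    using that rainbow_path_free_num_colors_le[OF _ assms(2)] by auto
  have "num_colors (path_graph n) (block_coloring m 0) = n - (n - 1) div m"
    using num_colors_block_coloring[of m 0 n] assms by simp
  then show "n - (n - 1) div m \<in>
      {num_colors (path_graph n) c | c. rainbow_path_free (Suc m) (path_graph n) c}"
    using rainbow_path_free_block_coloring[OF assms(1), of 0 n] by force
qed

section \<open>Optimal colorings, and uniqueness for multiples of \<open>m\<close>\<close>

lemma optimal_coloring_path_graph_iff:
  assumes "m > 0" "n \<ge> 1"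
  shows "optimal_coloring (Suc m) (path_graph n) c \<longleftrightarrow>
    rainbow_path_free (Suc m) (path_graph n) c \<and> card (repeats c n) = (n - 1) div m"
proof -
  have "(n - 1) div m \<le> n" by (meson diff_le_self div_le_dividend le_trans)
  then show ?thesis
    using card_colors_add_card_repeats[of c n]
    by (auto simp: optimal_coloring_def max_colors_path_graph[OF assms] num_colors_def)
qed

lemma optimal_coloring_repeats_mod:
  assumes "m > 0" "q > 0" "optimal_coloring (Suc m) (path_graph (q * m)) c"
    and "i \<in> repeats c (q * m)"
  shows "m dvd Suc i"
proof (rule ccontr)
  assume "\<not> m dvd Suc i"
  define J where "J = i div m"
  have i: "J * m \<le> i" "Suc i < J * m + m"
  proof -
    have "i mod m < m" using assms(1) by simp
    moreover have "Suc (i mod m) \<noteq> m"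
      using \<open>\<not> m dvd Suc i\<close> by (metis dvd_eq_mod_eq_0 mod_Suc)
    ultimately have "Suc (i mod m) < m" by simp
    moreover have "i = J * m + i mod m" by (simp add: J_def)
    ultimately show "J * m \<le> i" "Suc i < J * m + m" by linarith+
  qed
  \<comment> \<open>The intervals \<open>{s j..<s j + m}\<close> cover everything below
    \<open>J * m\<close>, then resume at \<open>J * m + (m - 1)\<close>. The gap contains
    \<open>i\<close>, and the shift by \<open>m - 1\<close> is small enough for the last window to
    end at \<open>q * m - 1\<close> at the latest.\<close>
  define s where "s j = (if j < J then j * m else j * m + (m - 1))" for j
  have mono: "x * m + m \<le> y * m" if "x < y" for x y
  proof -
    have "Suc x * m \<le> y * m" using that by (intro mult_right_mono) auto
    then show ?thesis by simp
  qed
  have 1: "s j + m < q * m" if "j < q - 1" for j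
    using mono[of j "q - 1"] mono[of "q - 1" q] that assms(1,2) by (auto simp: s_def)
  have 2: "s x + m \<le> s y" if "x < y" for x y
    using mono[OF that] that by (auto simp: s_def)
  have free: "rainbow_path_free (Suc m) (path_graph (q * m)) c"
    using assms(3) by (simp add: optimal_coloring_def)
  obtain f where f: "inj_on f {..<q - 1}"
    and fr: "\<And>j. j < q - 1 \<Longrightarrow> f j \<in> repeats c (q * m) \<and> s j \<le> f j \<and> f j < s j + m"
    using rainbow_path_free_repeats[OF free, of "q - 1" s] 1 2 by metis
  have "i \<notin> f ` {..<q - 1}"
  proof
    assume "i \<in> f ` {..<q - 1}"
    then obtain j where j: "j < q - 1" "i = f j" by auto
    show False
    proof (cases "j < J")
      case True
      then show ?thesis using fr[OF j(1)] j(2) i mono[OF True] by (simp add: s_def)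
    next
      case False
      then have "J * m \<le> j * m" by simp
      moreover have "j * m + (m - 1) \<le> i" using fr[OF j(1)] j(2) False by (auto simp only: s_def if_False)
      ultimately show ?thesis using i by linarith
    qed
  qed
  \<comment> \<open>Together with \<open>i\<close> there are \<open>q\<close> repeats, one more than
    optimality allows.\<close>
  then have "card (insert i (f ` {..<q - 1})) = q"
    using f assms(2) by (simp add: card_image)
  moreover have "insert i (f ` {..<q - 1}) \<subseteq> repeats c (q * m)"
    using fr assms(4) by auto
  ultimately have "q \<le> card (repeats c (q * m))"
    using card_mono[OF finite_subset[OF repeats_subset]] by (metis finite_lessThan)
  also have "\<dots> = (q * m - 1) div m"
    using assms(1-3) optimal_coloring_path_graph_iff[of m "q * m" c] by simp
  also have "\<dots> < q"
    using assms(1,2) by (simp add: div_less_iff_less_mult)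
  finally show False by simp
qed

lemma optimal_coloring_merges:
  assumes "m > 0" "optimal_coloring (Suc m) (path_graph (q * m)) c"
    and "Suc v < q * m" "m dvd Suc v"
  shows "c (Suc v) = c v"
proof -
  obtain j where j: "Suc v = j * m" using assms(4) by (metis dvdE mult.commute)
  then have "j > 0" "j < q" using assms(3) by (auto intro: gr0I)
  have a: "Suc v - m + m = Suc v" using j \<open>j > 0\<close> by (cases j) auto
  have free: "rainbow_path_free (Suc m) (path_graph (q * m)) c"
    using assms(2) by (simp add: optimal_coloring_def)
  then obtain x y where xy: "Suc v - m \<le> x" "x < y" "y \<le> Suc v" "c x = c y"
    using assms(3) a unfolding rainbow_path_free_path_graph_iff by metis
  then have "x \<in> repeats c (q * m)" using assms(3) by (auto simp: repeats_def)
  then have "m dvd Suc x"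
    using optimal_coloring_repeats_mod[OF assms(1) _ assms(2)] \<open>j < q\<close> by simp
  \<comment> \<open>Both \<open>Suc x\<close> and \<open>Suc v\<close> are multiples of
    \<open>m\<close>, and they differ by less than \<open>m\<close>; so \<open>x = v\<close>, which
    leaves only \<open>y = Suc v\<close>.\<close>
  then have "m dvd Suc v - Suc x" using assms(4) by (rule dvd_diff_nat[rotated])
  moreover have "Suc v - Suc x < m" using xy a assms(1) by linarith
  ultimately have "Suc v - Suc x = 0" using dvd_imp_le by fastforce
  with xy have "x = v" "y = Suc v" by auto
  with xy show ?thesis by simp
qed

text \<open>One implication suffices: the induced map \<open>h\<close> from the colors of
  \<open>c\<close> onto those of \<open>d\<close> is a surjection between finite sets of equal size,
  hence injective.\<close>

lemma same_coloringI:
  assumes "finite (verts G)" "num_colors G c = num_colors G d"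
    and "\<And>u v. u \<in> verts G \<Longrightarrow> v \<in> verts G \<Longrightarrow> c u = c v \<Longrightarrow> d u = d v"
  shows "same_coloring G c d"
proof -
  let ?V = "verts G"
  define h where "h = d \<circ> inv_into ?V c"
  have h: "h (c v) = d v" if "v \<in> ?V" for v
    unfolding h_def comp_def
    by (rule assms(3)) (use that in \<open>auto intro: inv_into_into f_inv_into_f\<close>)
  then have "h ` (c ` ?V) = d ` ?V" by (force simp: image_image)
  then have inj: "inj_on h (c ` ?V)"
    using assms(1,2) by (intro eq_card_imp_inj_on) (auto simp: num_colors_def)
  have iff: "d u = d v \<longleftrightarrow> c u = c v" if "u \<in> ?V" "v \<in> ?V" for u v
    using that assms(3) inj h by (metis imageI inj_onD)
  have classes: "color_classes G e = (\<lambda>w. {v \<in> ?V. e v = e w}) ` ?V" for e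
    by (auto simp: color_classes_def)
  have "(\<lambda>w. {v \<in> ?V. c v = c w}) ` ?V = (\<lambda>w. {v \<in> ?V. d v = d w}) ` ?V"
    by (rule image_cong) (use iff in auto)
  then show ?thesis by (simp add: same_coloring_def classes)
qed

lemma same_coloringD:
  assumes "same_coloring G c d" "u \<in> verts G" "v \<in> verts G" "c u = c v"
  shows "d u = d v"
proof -
  have "{w \<in> verts G. c w = c u} \<in> color_classes G c"
    using assms(2) by (auto simp: color_classes_def)
  then have "{w \<in> verts G. c w = c u} \<in> color_classes G d"
    using assms(1) by (simp add: same_coloring_def)
  then obtain i where i: "{w \<in> verts G. c w = c u} = {w \<in> verts G. d w = i}"
    by (auto simp: color_classes_def)
  have "u \<in> {w \<in> verts G. c w = c u}" "v \<in> {w \<in> verts G. c w = c u}"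
    using assms by auto
  then show ?thesis unfolding i by simp
qed

text \<open>The block coloring is nondecreasing, so equal values at \<open>u\<close> and
  \<open>v\<close> force every step between them to be a merge, which \<open>c\<close> also makes.
  Thus \<open>c\<close> is constant from \<open>u\<close> to \<open>v\<close>.\<close>

lemma block_coloring_eqD:
  assumes "m > 0" "u \<le> v" "block_coloring m 0 u = block_coloring m 0 v"
    and "\<And>w. Suc w \<le> v \<Longrightarrow> m dvd Suc w \<Longrightarrow> c (Suc w) = c w"
  shows "c u = c v"
  using assms(2-4)
proof (induction v rule: dec_induct)
  case base
  show ?case ..
next
  case (step v)
  have "mono (block_coloring m 0)"
    by (simp add: mono_iff_le_Suc block_coloring_Suc[OF assms(1)])
  then have "block_coloring m 0 u \<le> block_coloring m 0 v"
    using step.hyps by (simp add: monoD)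
  then have "m dvd Suc v" "block_coloring m 0 u = block_coloring m 0 v"
    using step.prems(1) block_coloring_Suc[OF assms(1), of 0 v] by (auto split: if_splits)
  with step show ?case by (metis le_SucI order_refl)
qed

lemma unique_optimal_coloring_path_graph_mult:
  assumes "m > 0" "q > 0"
  shows "unique_optimal_coloring (Suc m) (path_graph (q * m))"
proof -
  let ?G = "path_graph (q * m)"
  have n: "q * m \<ge> 1" using assms by simp
  have opt: "optimal_coloring (Suc m) ?G (block_coloring m 0)"
    using max_colors_path_graph[OF assms(1) n] num_colors_block_coloring[of m 0 "q * m"]
      rainbow_path_free_block_coloring[of m 0] assms n
    by (simp add: optimal_coloring_def)
  have "same_coloring ?G (block_coloring m 0) d" if d: "optimal_coloring (Suc m) ?G d" for d
  proof (rule same_coloringI)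
    show "num_colors ?G (block_coloring m 0) = num_colors ?G d"
      using opt d by (simp add: optimal_coloring_def)
    fix u v assume uv: "u \<in> verts ?G" "v \<in> verts ?G" "block_coloring m 0 u = block_coloring m 0 v"
    have merge: "d (Suc w) = d w" if "Suc w < q * m" "m dvd Suc w" for w
      using optimal_coloring_merges[OF assms(1) d that] .
    show "d u = d v"
    proof (cases "u \<le> v")
      case True
      then show ?thesis
        by (rule block_coloring_eqD[OF assms(1)]) (use uv merge in auto)
    next
      case False
      then have "v \<le> u" by simp
      then have "d v = d u"
        by (rule block_coloring_eqD[OF assms(1)]) (use uv merge in auto)
      then show ?thesis ..
    qed
  qed simp
  with opt show ?thesis by (auto simp: unique_optimal_coloring_def)
qed

section \<open>Two optimal colorings when \<open>m\<close> does not divide \<open>n\<close>\<close>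

lemma not_unique_optimal_coloring_path_graph:
  assumes "m \<le> n" "\<not> m dvd n" "m > 0"
  shows "\<not> unique_optimal_coloring (Suc m) (path_graph n)"
proof
  let ?G = "path_graph n"
  assume "unique_optimal_coloring (Suc m) ?G"
  then obtain c where c: "\<And>d. optimal_coloring (Suc m) ?G d \<Longrightarrow> same_coloring ?G c d"
    by (auto simp: unique_optimal_coloring_def)
  have m: "m \<ge> 2" using assms by (cases "m = 1") auto
  have n: "n \<ge> 1" using assms by simp
  obtain p where p: "n = Suc p" using n by (cases n) auto
  \<comment> \<open>The shifted coloring has \<open>n div m\<close> merges, so non-divisibility is
    what keeps it optimal.\<close>
  have div: "n div m = (n - 1) div m"
    using assms(2) p by (simp add: div_Suc dvd_eq_mod_eq_0)
  have "optimal_coloring (Suc m) ?G (block_coloring m s)" if "s \<le> 1" for s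
  proof -
    have "s = 0 \<or> s = 1" using that by auto
    then have eq: "(n - 1 + s) div m = (n - 1) div m" using div n by auto
    have "num_colors ?G (block_coloring m s) = n - (n - 1 + s) div m"
      by (rule num_colors_block_coloring) (use assms(3) that n eq in auto)
    then show ?thesis
      using eq max_colors_path_graph[OF assms(3) n]
        rainbow_path_free_block_coloring[OF assms(3) that]
      by (simp add: optimal_coloring_def)
  qed
  then have same: "same_coloring ?G c (block_coloring m 0)" "same_coloring ?G c (block_coloring m 1)"
    using c by auto
  then have "same_coloring ?G (block_coloring m 1) (block_coloring m 0)"
    by (simp add: same_coloring_def)
  \<comment> \<open>The first merge for \<open>s = 1\<close> separates the two colorings: for
    \<open>s = 0\<close> these vertices, which exist since \<open>2 \<le> m \<le> n\<close>, still
    have different colors.\<close>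
  moreover have "block_coloring m 1 (m - 2) = block_coloring m 1 (m - 1)"
    using m by (simp add: block_coloring_def)
  ultimately have "block_coloring m 0 (m - 2) = block_coloring m 0 (m - 1)"
    using same_coloringD[of ?G "block_coloring m 1" "block_coloring m 0" "m - 2" "m - 1"] m assms(1)
    by simp
  with m show False by (simp add: block_coloring_def)
qed

section \<open>The floor formula and the theorem\<close>

lemma floor_max_colors_formula:
  assumes "m > 0" "n \<ge> 1"
  shows "int (n - (n - 1) div m) = \<lfloor>(real m - 1) * real n / real m\<rfloor> + 1"
proof -
  define t r where "t = (n - 1) div m" and "r = (n - 1) mod m"
  have r: "r < m" using assms by (simp add: r_def)
  have nn: "n = t * m + r + 1"
    using assms div_mult_mod_eq[of "n - 1" m] unfolding t_def r_def by linarith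
  have "t \<le> t * m" using assms by simp
  then have le: "t \<le> n" using nn by linarith
  \<comment> \<open>The left side is the floor of \<open>n - n / m\<close>. Here
    \<open>n / m\<close> exceeds \<open>t\<close> by \<open>(r + 1) / m\<close>, which lies in the
    half-open interval from 0 (excluded) to 1 (included).\<close>
  have "\<lfloor>(real m - 1) * real n / real m\<rfloor> = int n - int t - 1"
  proof (rule floor_unique)
    have "(real m - 1) * real n / real m = real n - real n / real m"
      using assms by (simp add: field_simps)
    moreover have "real n / real m = real t + (real r + 1) / real m"
      using assms by (simp add: nn field_simps)
    moreover have "0 < (real r + 1) / real m" "(real r + 1) / real m \<le> 1"
      using r by auto
    ultimately show "of_int (int n - int t - 1) \<le> (real m - 1) * real n / real m"
      "(real m - 1) * real n / real m < of_int (int n - int t - 1) + 1"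
      by simp_all
  qed
  then show ?thesis using le unfolding t_def[symmetric] by simp
qed

theorem theorem1:
  fixes k :: nat
  assumes "k \<ge> 2"
  shows "(\<forall>n\<ge>1. int (max_colors k (path_graph n)) =
             \<lfloor>(real k - 2) * real n / (real k - 1)\<rfloor> + 1) \<and>
         (\<forall>n\<ge>k - 1. unique_optimal_coloring k (path_graph n) \<longleftrightarrow> (k - 1) dvd n)"
proof -
  obtain m where m: "k = Suc m" "m > 0" using assms by (cases k) auto
  have "int (max_colors k (path_graph n)) = \<lfloor>(real k - 2) * real n / (real k - 1)\<rfloor> + 1"
    if "n \<ge> 1" for n
    using max_colors_path_graph[OF m(2) that] floor_max_colors_formula[OF m(2) that] m(1) by simp
  moreover have "unique_optimal_coloring k (path_graph n) \<longleftrightarrow> (k - 1) dvd n" if "n \<ge> k - 1" for n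
  proof
    assume "unique_optimal_coloring k (path_graph n)"
    then show "(k - 1) dvd n"
      using not_unique_optimal_coloring_path_graph[of m n] m that by auto
  next
    assume "(k - 1) dvd n"
    then obtain q where "n = q * m" using m by (metis diff_Suc_1 dvdE mult.commute)
    \<comment> \<open>The bound \<open>n \<ge> k - 1\<close> excludes the empty path.\<close>
    moreover have "q > 0" using that m calculation by (intro gr0I) auto
    ultimately show "unique_optimal_coloring k (path_graph n)"
      using unique_optimal_coloring_path_graph_mult[OF m(2)] m(1) by simp
  qed
  ultimately show ?thesis by blast
qed

end
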